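(* Let $V\subseteq\{0,1\}^7$ be the following set of points, each written as a string of its $7$ coordinates (the $j$th digit is the $j$th coordinate): \[ \begin{aligned} V=\{\,&0010110,\ 1011101,\ 1000100,\ 1001010,\ 0111000,\ 1100001,\ 0010001,\\ &0001100,\ 0100010,\ 1001111,\ 1101110,\ 0110101,\ 1110011,\ 0111011\,\}, \end{aligned} \] and let $P=\operatorname{conv}(V)\subseteq[0,1]^7\subseteq\mathbb{R}^7$. Then $P$ is a simplicial $7$-dimensional $0/1$-polytope with exactly $14=2\cdot 7$ vertices, and $P$ is not centrally symmetric. Consequently, it is not true that every simplicial $d$-dimensional $0/1$-polytope with $2d$ vertices is a cross polytope.
   Context: A $0/1$-polytope in $\mathbb{R}^d$ is the convex hull of a subset of $\{0,1\}^d$. A $d$-dimensional polytope is simplicial if every facet of it is a simplex of dimension $d-1$. Let $\mathbf{1}=(1,\dots,1)$. A $0/1$-polytope $\operatorname{conv}(V)$ with $V\subseteq\{0,1\}^d$ is centrally symmetric if its vertex set $V$ is closed under the map $v\mapsto\mathbf{1}-v$, i.e. $\mathbf{1}-v\in V$ for every $v\in V$ (symmetry with respect to the cube center $\tfrac12\mathbf{1}$). A $d$-dimensional polytope is called a cross polytope if it is affinely isomorphic to $\operatorname{conv}\{\pm\mathbf{e}_1,\dots,\pm\mathbf{e}_d\}\subseteq\mathbb{R}^d$, where $\mathbf{e}_i$ is the $i$th standard unit vector. *)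

theory Defs
  imports "HOL-Analysis.Analysis" "HOL-Analysis.Finite_Function_Topology"
begin

text \<open>
  The dimension \<open>d\<close> is quantified inside the theorem, so it cannot be a type. We work in the
  vector space of finitely supported sequences \<open>nat \<Rightarrow>\<^sub>0 real\<close> and identify \<open>\<real>\<^sup>d\<close> with the
  subspace of the sequences supported in \<open>{..<d}\<close>; the \<open>j\<close>th coordinate has index \<open>j - 1\<close>.

  The library constants \<open>aff_dim\<close>, \<open>facet_of\<close> and \<open>simplex\<close> are restricted to the class
  \<open>euclidean_space\<close>, which this type does not belong to. The first three definitions repeat them
  over \<open>real_vector\<close>, and the lemmas after them show that they agree with the library on Euclidean
  spaces.
\<close>

definition has_aff_dim :: "'a::real_vector set \<Rightarrow> int \<Rightarrow> bool" where
  "has_aff_dim S k \<longleftrightarrow>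
     (\<exists>B. finite B \<and> \<not> affine_dependent B \<and> affine hull B = affine hull S \<and> int (card B) = k + 1)"

definition is_facet :: "'a::real_vector set \<Rightarrow> 'a set \<Rightarrow> bool" where
  "is_facet F S \<longleftrightarrow>
     F face_of S \<and> F \<noteq> {} \<and> (\<exists>k. has_aff_dim S k \<and> has_aff_dim F (k - 1))"

definition is_simplex :: "int \<Rightarrow> 'a::real_vector set \<Rightarrow> bool" where
  "is_simplex k S \<longleftrightarrow>
     (\<exists>C. finite C \<and> \<not> affine_dependent C \<and> int (card C) = k + 1 \<and> S = convex hull C)"

lemma has_aff_dim_iff_aff_dim:
  fixes S :: "'a::euclidean_space set"
  shows "has_aff_dim S k \<longleftrightarrow> aff_dim S = k"
proof
  assume "has_aff_dim S k"
  then obtain B where B: "\<not> affine_dependent B" "affine hull B = affine hull S"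
      "int (card B) = k + 1"
    unfolding has_aff_dim_def by blast
  then show "aff_dim S = k"
    using aff_dim_unique[of B S] by simp
next
  assume k: "aff_dim S = k"
  obtain B where B: "affine hull B = affine hull S" "\<not> affine_dependent B"
      "int (card B) = aff_dim S + 1"
    using aff_dim_basis_exists[of S] by auto
  then show "has_aff_dim S k"
    unfolding has_aff_dim_def using k aff_independent_finite by blast
qed

lemma is_facet_iff_facet_of:
  fixes S :: "'a::euclidean_space set"
  shows "is_facet F S \<longleftrightarrow> F facet_of S"
  by (auto simp: is_facet_def facet_of_def has_aff_dim_iff_aff_dim)

lemma is_simplex_iff_simplex:
  fixes S :: "'a::euclidean_space set"
  shows "is_simplex k S \<longleftrightarrow> k simplex S"
  unfolding is_simplex_def simplex_def using aff_independent_finite by blast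

definition vertices :: "'a::real_vector set \<Rightarrow> 'a set" where
  "vertices P = {v. v extreme_point_of P}"

definition simplicial_polytope :: "nat \<Rightarrow> 'a::real_vector set \<Rightarrow> bool" where
  "simplicial_polytope d P \<longleftrightarrow>
     polytope P \<and> has_aff_dim P (int d) \<and> (\<forall>F. is_facet F P \<longrightarrow> is_simplex (int d - 1) F)"

definition zero_one_points :: "nat \<Rightarrow> (nat \<Rightarrow>\<^sub>0 real) set" where
  "zero_one_points d =
     {x. Poly_Mapping.keys x \<subseteq> {..<d} \<and> (\<forall>i<d. Poly_Mapping.lookup x i \<in> {0, 1})}"

definition zero_one_polytope :: "nat \<Rightarrow> (nat \<Rightarrow>\<^sub>0 real) set \<Rightarrow> bool" where
  "zero_one_polytope d P \<longleftrightarrow> (\<exists>V \<subseteq> zero_one_points d. P = convex hull V)"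

definition all_ones :: "nat \<Rightarrow> (nat \<Rightarrow>\<^sub>0 real)" where
  "all_ones d = (\<Sum>i<d. Poly_Mapping.single i 1)"

definition centrally_symmetric :: "nat \<Rightarrow> (nat \<Rightarrow>\<^sub>0 real) set \<Rightarrow> bool" where
  "centrally_symmetric d P \<longleftrightarrow> (\<forall>v \<in> vertices P. all_ones d - v \<in> vertices P)"

text \<open>An affine map on \<open>affine hull S\<close> always extends to the whole space, so requiring the linear
  part \<open>f\<close> to be defined everywhere is no restriction.\<close>

definition affinely_isomorphic :: "'a::real_vector set \<Rightarrow> 'b::real_vector set \<Rightarrow> bool" where
  "affinely_isomorphic S T \<longleftrightarrow>
     (\<exists>f a. linear f \<and> inj_on (\<lambda>x. a + f x) (affine hull S) \<and> (\<lambda>x. a + f x) ` S = T)"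

definition standard_cross_polytope :: "nat \<Rightarrow> (nat \<Rightarrow>\<^sub>0 real) set" where
  "standard_cross_polytope d =
     convex hull (\<Union>i<d. {Poly_Mapping.single i 1, - Poly_Mapping.single i 1})"

definition cross_polytope :: "nat \<Rightarrow> (nat \<Rightarrow>\<^sub>0 real) set \<Rightarrow> bool" where
  "cross_polytope d P \<longleftrightarrow> affinely_isomorphic P (standard_cross_polytope d)"

text \<open>\<open>Poly_Mapping.nth xs\<close> is the sequence with the entries of the list \<open>xs\<close> followed by
  zeros.\<close>

abbreviation point :: "real list \<Rightarrow> (nat \<Rightarrow>\<^sub>0 real)" where
  "point \<equiv> Poly_Mapping.nth"

end

theory Submission
  imports Defs
begin

text \<open>
  With \<open>z = (1/2, \<dots>, 1/2)\<close>, the fourteen points are five antipodal pairs \<open>z \<plusminus> u j\<close> together with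
  four points \<open>z + a\<close>, \<open>z + b\<close>, \<open>z + c\<close>, \<open>z + e\<close>. The nine vectors \<open>u j\<close>, \<open>a\<close>, \<open>b\<close>, \<open>c\<close>, \<open>e\<close>
  span a space of dimension 7, so their linear relations are generated by two:
  \<open>a + b + c + e = 0\<close> and \<open>(\<Sum>j. d j * u j) = 6 * b + 7 * e - c\<close> with \<open>d = (3, 2, 3, 2, 4)\<close>.
  A cross polytope would have two more antipodal pairs in place of \<open>a, b, c, e\<close>; the four points form
  a tetrahedron with centroid \<open>z\<close> instead, which is what destroys the central symmetry.

  That \<open>P\<close> is simplicial follows from these relations without listing its 136 facets. Move \<open>z\<close> to the
  origin; then the origin lies in no proper face. Suppose that a combination of some vertices with
  positive weights of total \<open>r\<close> equals a combination of vertices with nonnegative weights of total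
  \<open>s < r\<close>. Then the barycentre of the former vertices is the origin or lies strictly between the
  origin and a point of \<open>P\<close>, so these vertices cannot all lie on one proper face. Applied
  to rearrangements of the two relations, this forbids enough sets of vertices (\<open>excluded_subsets\<close>)
  that a proper face contains at most seven vertices (\<open>card_vertices_in_proper_face\<close>). A facet is the
  convex hull of its vertices and has dimension 6, so it has exactly seven of them and they are
  affinely independent (\<open>simplicial_polytope_if_faces_small\<close>).

  For the last claim, the cross polytope is symmetric about the origin, so a polytope affinely
  isomorphic to it is mapped to itself by some reflection \<open>x \<mapsto> s - x\<close>. For \<open>P\<close> the vector \<open>s\<close> must be
  the all-ones vector, because \<open>P\<close> lies in the cube and contains an antipodal pair of cube vertices;
  but the antipode of the first point is a cube vertex that is not in \<open>V\<close>, hence not in \<open>P\<close>.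
\<close>

section \<open>Affine dimension in real vector spaces\<close>

text \<open>
  Subtracting a point of each set turns affine independence and affine hulls into linear independence
  and spans, where the exchange lemma compares the two cardinalities.
\<close>
lemma affine_independent_card_le:
  fixes B C :: "'a::real_vector set"
  assumes B: "\<not> affine_dependent B" and C: "finite C" and sub: "affine hull B \<subseteq> affine hull C"
  shows "card B \<le> card C"
proof (cases "B = {}")
  case False
  then obtain b where b: "b \<in> B" by blast
  then have "b \<in> affine hull C" by (rule subsetD[OF sub hull_inc])
  then obtain c where c: "c \<in> C" by (metis affine_hull_empty empty_iff equals0I)
  let ?D = "(\<lambda>x. - c + x) ` (C - {c})" and ?E = "(\<lambda>x. - b + x) ` (B - {b})"
  have diff: "x - c \<in> span ?D" if "x \<in> B" for x
  proof -
    have "x \<in> affine hull C" using that by (rule subsetD[OF sub hull_inc])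
    then show ?thesis unfolding affine_hull_span2[OF c] by auto
  qed
  have "?E \<subseteq> span ?D"
  proof
    fix y assume "y \<in> ?E"
    then obtain x where x: "x \<in> B" "y = (x - c) - (b - c)" by auto
    show "y \<in> span ?D" unfolding x(2) by (intro span_diff diff x b)
  qed
  moreover have "independent ?E" using B affine_dependent_iff_dependent2[OF b] by blast
  ultimately have "finite ?E \<and> card ?E \<le> card ?D"
    using C by (intro independent_span_bound) auto
  moreover have "card ?E = card (B - {b})" "card ?D = card (C - {c})"
    by (auto intro!: card_image)
  moreover have "finite (B - {b})"
    using calculation(1) finite_imageD[of "(\<lambda>x. - b + x)" "B - {b}"] by auto
  ultimately have "card B - 1 \<le> card C - 1" using b c by simp
  moreover have "card C > 0" using c C by (auto simp: card_gt_0_iff)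
  ultimately show ?thesis by linarith
qed simp

lemma has_aff_dim_unique:
  assumes "has_aff_dim S k" "has_aff_dim S l"
  shows "k = l"
proof -
  obtain B C where B: "finite B" "\<not> affine_dependent B" "affine hull B = affine hull S"
      "int (card B) = k + 1"
    and C: "finite C" "\<not> affine_dependent C" "affine hull C = affine hull S"
      "int (card C) = l + 1"
    using assms unfolding has_aff_dim_def by blast
  then have "card B \<le> card C" "card C \<le> card B"
    by (simp_all add: affine_independent_card_le)
  then show ?thesis using B C by simp
qed

text \<open>
  A \<open>k\<close>-dimensional set is not generated by fewer than \<open>k + 1\<close> points, so \<open>T\<close> has no proper subset
  with the same affine hull and is affinely independent.
\<close>
lemma is_simplex_if_few_generators:
  assumes "has_aff_dim (convex hull T) k" "finite T" "int (card T) \<le> k + 1"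
  shows "is_simplex k (convex hull T)"
proof -
  obtain B where B: "finite B" "\<not> affine_dependent B" "affine hull B = affine hull T"
      "int (card B) = k + 1"
    using assms(1) unfolding has_aff_dim_def by (auto simp: affine_hull_convex_hull)
  obtain C where C: "C \<subseteq> T" "\<not> affine_dependent C" "affine hull T = affine hull C"
    using affine_basis_exists[of T] by blast
  have "finite C" using C assms(2) finite_subset by blast
  then have "card B \<le> card C" using B C by (intro affine_independent_card_le) auto
  moreover have "card C \<le> card T" using C assms(2) by (simp add: card_mono)
  ultimately have "card C = card T" "int (card T) = k + 1" using B assms(3) by linarith+
  then have "C = T" using C(1) assms(2) card_subset_eq by blast
  then show ?thesis
    unfolding is_simplex_def using C assms(2) \<open>int (card T) = k + 1\<close> by blast
qed

section \<open>Faces of convex hulls\<close>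

text \<open>
  The points of the hull that, if they lie in \<open>F\<close>, lie in the hull of \<open>F \<inter> V\<close>, form a convex
  set: a point of \<open>F\<close> inside a segment forces both ends into \<open>F\<close>.
\<close>
lemma face_of_convex_hull_eq:
  assumes "F face_of convex hull V"
  shows "F = convex hull (F \<inter> V)"
proof
  define C where "C = {x \<in> convex hull V. x \<in> F \<longrightarrow> x \<in> convex hull (F \<inter> V)}"
  have "convex C"
    unfolding convex_contains_open_segment
  proof (intro ballI subsetI)
    fix x y z assume xy: "x \<in> C" "y \<in> C" and z: "z \<in> open_segment x y"
    have "z \<in> convex hull V"
      using xy z convex_convex_hull[of V] unfolding C_def convex_contains_open_segment by blast
    moreover have "z \<in> convex hull (F \<inter> V)" if "z \<in> F"
    proof -
      have "x \<in> F" "y \<in> F"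
        using face_ofD[OF assms z _ _ that] xy by (auto simp: C_def)
      then show ?thesis
        using xy z convex_convex_hull[of "F \<inter> V"]
        unfolding C_def convex_contains_open_segment by blast
    qed
    ultimately show "z \<in> C" by (simp add: C_def)
  qed
  moreover have "V \<subseteq> C" by (auto simp: C_def hull_inc)
  ultimately have "convex hull V \<subseteq> C" by (rule hull_minimal[rotated])
  then show "F \<subseteq> convex hull (F \<inter> V)"
    using face_of_imp_subset[OF assms] by (auto simp: C_def)
  show "convex hull (F \<inter> V) \<subseteq> F"
    by (rule hull_minimal) (auto intro: face_of_imp_convex[OF assms])
qed

text \<open>
  A facet is the hull of the points of \<open>V\<close> on it. Having dimension \<open>d - 1\<close>, it contains at least
  \<open>d\<close> of them, hence by the bound exactly \<open>d\<close>, and they are affinely independent.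
\<close>
lemma simplicial_polytope_if_faces_small:
  assumes V: "finite V" and dim: "has_aff_dim (convex hull V) (int d)"
    and few: "\<And>F. F face_of convex hull V \<Longrightarrow> F \<noteq> convex hull V \<Longrightarrow> card (F \<inter> V) \<le> d"
  shows "simplicial_polytope d (convex hull V)"
  unfolding simplicial_polytope_def
proof (intro conjI allI impI)
  show "polytope (convex hull V)" using V unfolding polytope_def by blast
  fix F assume F: "is_facet F (convex hull V)"
  obtain k where "has_aff_dim (convex hull V) k" and k: "has_aff_dim F (k - 1)"
    using F unfolding is_facet_def by blast
  then have "k = int d" using has_aff_dim_unique[OF dim] by blast
  have face: "F face_of convex hull V" using F unfolding is_facet_def by blast
  have F_eq: "F = convex hull (F \<inter> V)" by (rule face_of_convex_hull_eq[OF face])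
  have "F \<noteq> convex hull V"
    using has_aff_dim_unique[OF dim, of "k - 1"] k \<open>k = int d\<close> by auto
  then have "card (F \<inter> V) \<le> d" by (rule few[OF face])
  then have "is_simplex (int d - 1) (convex hull (F \<inter> V))"
    using V k F_eq \<open>k = int d\<close> by (intro is_simplex_if_few_generators) auto
  then show "is_simplex (int d - 1) F" using F_eq by simp
qed (rule dim)

text \<open>
  Unless \<open>x\<close> is the origin, the origin lies strictly between \<open>x\<close> and a negative multiple of \<open>x\<close>.
\<close>
lemma face_contains_if_zero:
  fixes S :: "'a::real_vector set"
  assumes F: "F face_of S" and 0: "0 \<in> F" and x: "x \<in> S" and y: "- t *\<^sub>R x \<in> S" and t: "0 < t"
  shows "x \<in> F"
proof (cases "x = 0")
  case False
  define r where "r = inverse (1 + t)"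
  have r: "0 < r" "r < 1" "1 - r + r * (- t) = 0"
    using t by (simp_all add: r_def field_simps)
  have "0 = (1 - r + r * (- t)) *\<^sub>R x" by (simp only: r scaleR_zero_left)
  also have "\<dots> = (1 - r) *\<^sub>R x + r *\<^sub>R (- t *\<^sub>R x)"
    by (simp only: scaleR_add_left scaleR_scaleR)
  finally have "0 = (1 - r) *\<^sub>R x + r *\<^sub>R (- t *\<^sub>R x)" .
  moreover have "x \<noteq> - t *\<^sub>R x"
  proof
    assume "x = - t *\<^sub>R x"
    then have "(1 + t) *\<^sub>R x = 0"
      by (simp add: scaleR_add_left eq_neg_iff_add_eq_0)
    with t False show False by simp
  qed
  ultimately have "0 \<in> open_segment x (- t *\<^sub>R x)"
    unfolding in_segment using r by blast
  then show ?thesis using face_ofD[OF F _ x y 0] by blast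
qed (use 0 in simp)

text \<open>
  Unless it is the origin, \<open>x = (s / r) * y\<close> lies strictly between the origin and \<open>y\<close>.
\<close>
lemma zero_in_face:
  fixes S :: "'a::real_vector set"
  assumes F: "F face_of S" and S: "0 \<in> S" and x: "x \<in> F" and y: "y \<in> S"
    and eq: "r *\<^sub>R x = s *\<^sub>R y" and rs: "0 \<le> s" "s < r"
  shows "0 \<in> F"
proof (cases "x = 0 \<or> s = 0")
  case True
  then show ?thesis using x eq rs by auto
next
  case False
  then have nz: "x \<noteq> 0" "0 < s" using rs by auto
  have "x = inverse r *\<^sub>R (r *\<^sub>R x)" using rs by simp
  also have "\<dots> = (s / r) *\<^sub>R y" by (simp only: eq scaleR_scaleR divide_inverse mult.commute)
  finally have "x = (s / r) *\<^sub>R y" .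
  moreover have "0 < s / r" "s / r < 1" using nz rs by simp_all
  moreover from this have "y \<noteq> 0" using nz calculation(1) by auto
  ultimately have "x \<in> open_segment 0 y"
    unfolding in_segment by (intro conjI exI[of _ "s / r"]) simp_all
  then show ?thesis using face_ofD[OF F _ S y x] by blast
qed

section \<open>Forbidden sets of vertices\<close>

text \<open>
  A combination of points of a convex set \<open>S\<close> with nonnegative weights of total \<open>t\<close> is a point of the
  dilate \<open>t * S\<close>. Adding dilates adds the totals, which is the bookkeeping needed to compare the total
  weights of the two sides of a linear relation.
\<close>

lemma scaled_mem: "x \<in> S \<Longrightarrow> t *\<^sub>R x \<in> (*\<^sub>R) t ` S"
  by blast

lemma scaled_add:
  assumes S: "convex S" and s: "0 \<le> s" and t: "0 \<le> t"
    and x: "x \<in> (*\<^sub>R) s ` S" and y: "y \<in> (*\<^sub>R) t ` S"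
  shows "x + y \<in> (*\<^sub>R) (s + t) ` S"
proof -
  obtain p q where p: "p \<in> S" "x = s *\<^sub>R p" and q: "q \<in> S" "y = t *\<^sub>R q"
    using x y by blast
  show ?thesis
  proof (cases "s + t = 0")
    case True
    then have "s = 0" "t = 0" using s t by linarith+
    then show ?thesis using p q by auto
  next
    case False
    then have "0 < s + t" using s t by linarith
    then have "(s / (s + t)) *\<^sub>R p + (t / (s + t)) *\<^sub>R q \<in> S"
      using S s t p q by (intro convexD) (auto simp flip: add_divide_distrib)
    moreover have "x + y = (s + t) *\<^sub>R ((s / (s + t)) *\<^sub>R p + (t / (s + t)) *\<^sub>R q)"
      using False by (simp add: p q scaleR_add_right)
    ultimately show ?thesis by blast
  qed
qed

lemma scaled_sum:
  assumes "convex S" "0 \<in> S" "finite J" "\<And>j. j \<in> J \<Longrightarrow> 0 \<le> d j" "\<And>j. j \<in> J \<Longrightarrow> x j \<in> S"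
  shows "(\<Sum>j\<in>J. d j *\<^sub>R x j) \<in> (*\<^sub>R) (\<Sum>j\<in>J. d j) ` S"
  using assms(3-5)
proof (induction J rule: finite_induct)
  case empty
  then show ?case using assms(2) by auto
next
  case (insert j J)
  then show ?case
    by (auto intro!: scaled_add assms(1) sum_nonneg scaled_mem)
qed

lemma zero_in_face_scaled:
  assumes "F face_of S" "0 \<in> S" "v \<in> (*\<^sub>R) r ` F" "v \<in> (*\<^sub>R) s ` S" "0 \<le> s" "s < r"
  shows "0 \<in> F"
  using assms zero_in_face by blast

text \<open>
  Each claim compares total weights in a rearrangement of the two given relations, with the points
  assumed to lie in \<open>F\<close> on the left. Write \<open>D\<close> for \<open>sum d J\<close>.
  \<^item> \<open>(m + 1) a + b + (m + 2) c = (\<Sum>j\<in>J. d j (- u j))\<close> has totals \<open>2 m + 4 > D\<close>.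
  \<^item> \<open>m a + (m + 1) c + d j u j = e + (\<Sum>i\<in>J - {j}. d i (- u i))\<close> has totals
    \<open>2 m + 1 + d j > 1 + D - d j\<close>.
  \<^item> \<open>c + (\<Sum>j\<in>J. d j u j) = m b + (m + 1) e\<close> has totals \<open>1 + D > 2 m + 1\<close>.

  These are exactly the inequalities assumed for \<open>m\<close> and \<open>d\<close>.
\<close>
lemma excluded_subsets:
  fixes u :: "'j \<Rightarrow> 'a::real_vector" and d :: "'j \<Rightarrow> real"
  assumes F: "F face_of S" and S: "convex S" "0 \<in> S" and F0: "0 \<notin> F" and J: "finite J"
    and u: "\<And>j. j \<in> J \<Longrightarrow> u j \<in> S" "\<And>j. j \<in> J \<Longrightarrow> - u j \<in> S"
    and abce: "a \<in> S" "b \<in> S" "c \<in> S" "e \<in> S" "a + b + c + e = 0"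
    and rel: "(\<Sum>j\<in>J. d j *\<^sub>R u j) = m *\<^sub>R b + (m + 1) *\<^sub>R e - c"
    and m: "0 \<le> m" "2 * m < sum d J" "sum d J < 2 * m + 4"
    and d: "\<And>j. j \<in> J \<Longrightarrow> sum d J - 2 * m < 2 * d j"
  shows "\<not> (a \<in> F \<and> b \<in> F \<and> c \<in> F)"
    and "j \<in> J \<Longrightarrow> \<not> (a \<in> F \<and> c \<in> F \<and> u j \<in> F)"
    and "\<not> (c \<in> F \<and> (\<forall>j\<in>J. u j \<in> F))"
proof -
  have convF: "convex F" using F by (rule face_of_imp_convex)
  have d0: "0 \<le> d j" if "j \<in> J" for j using d[OF that] m by linarith
  have e: "e = - (a + b + c)" using minus_unique[OF abce(5)] by simp
  define N where "N = (\<Sum>j\<in>J. d j *\<^sub>R (- u j))"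
  have N: "N = - (m *\<^sub>R b + (m + 1) *\<^sub>R e - c)"
    unfolding N_def rel[symmetric] by (simp add: sum_negf)
  have NS: "N \<in> (*\<^sub>R) (sum d J) ` S"
    unfolding N_def by (intro scaled_sum S J d0 u)
  note zero = zero_in_face_scaled[OF F S(2), THEN F0[THEN notE]]
  show "\<not> (a \<in> F \<and> b \<in> F \<and> c \<in> F)"
  proof
    assume "a \<in> F \<and> b \<in> F \<and> c \<in> F"
    then have "(m + 1) *\<^sub>R a + 1 *\<^sub>R b + (m + 2) *\<^sub>R c \<in> (*\<^sub>R) (m + 1 + 1 + (m + 2)) ` F"
      using m by (intro scaled_add convF scaled_mem) auto
    moreover have "(m + 1) *\<^sub>R a + 1 *\<^sub>R b + (m + 2) *\<^sub>R c = N"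
      unfolding N e by (simp add: algebra_simps scaleR_2)
    ultimately have "N \<in> (*\<^sub>R) (m + 1 + 1 + (m + 2)) ` F" by simp
    then show False by (rule zero[OF _ NS]) (use m in simp_all)
  qed
  show "\<not> (c \<in> F \<and> (\<forall>j\<in>J. u j \<in> F))"
  proof
    assume c: "c \<in> F \<and> (\<forall>j\<in>J. u j \<in> F)"
    show False
    proof (cases "J = {}")
      case True
      then show False using m by simp
    next
      case False
      let ?v = "m *\<^sub>R b + (m + 1) *\<^sub>R e"
      have v: "?v \<in> (*\<^sub>R) (m + (m + 1)) ` S"
        using m abce by (intro scaled_add S scaled_mem) auto
      have D: "0 < sum d J" using m by linarith
      have "(\<Sum>j\<in>J. (d j / sum d J) *\<^sub>R u j) \<in> F"
        using c D by (intro convex_sum convF J) (auto simp: d0 simp flip: sum_divide_distrib)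
      then have "sum d J *\<^sub>R (\<Sum>j\<in>J. (d j / sum d J) *\<^sub>R u j) \<in> (*\<^sub>R) (sum d J) ` F"
        by (rule scaled_mem)
      moreover have "sum d J *\<^sub>R (\<Sum>j\<in>J. (d j / sum d J) *\<^sub>R u j) = (\<Sum>j\<in>J. d j *\<^sub>R u j)"
        using D by (simp add: scaleR_sum_right)
      ultimately have "1 *\<^sub>R c + (\<Sum>j\<in>J. d j *\<^sub>R u j) \<in> (*\<^sub>R) (1 + sum d J) ` F"
        using c D by (intro scaled_add convF scaled_mem) auto
      then have "?v \<in> (*\<^sub>R) (1 + sum d J) ` F" by (simp add: rel)
      then show False by (rule zero[OF _ v]) (use m in simp_all)
    qed
  qed
  assume j: "j \<in> J"
  show "\<not> (a \<in> F \<and> c \<in> F \<and> u j \<in> F)"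
  proof
    assume "a \<in> F \<and> c \<in> F \<and> u j \<in> F"
    then have F': "m *\<^sub>R a + (m + 1) *\<^sub>R c + d j *\<^sub>R u j \<in> (*\<^sub>R) (m + (m + 1) + d j) ` F"
      using m d0[OF j] by (intro scaled_add convF scaled_mem) auto
    let ?v = "1 *\<^sub>R e + (\<Sum>i\<in>J - {j}. d i *\<^sub>R (- u i))"
    have v: "?v \<in> (*\<^sub>R) (1 + sum d (J - {j})) ` S"
      using J u abce d0 by (intro scaled_add S scaled_mem scaled_sum sum_nonneg) auto
    have "N = d j *\<^sub>R (- u j) + (\<Sum>i\<in>J - {j}. d i *\<^sub>R (- u i))"
      unfolding N_def using J j by (rule sum.remove)
    then have "?v = e + (N + d j *\<^sub>R u j)" by simp
    also have "\<dots> = m *\<^sub>R a + (m + 1) *\<^sub>R c + d j *\<^sub>R u j"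
      unfolding N e by (simp add: algebra_simps)
    finally have vF: "?v \<in> (*\<^sub>R) (m + (m + 1) + d j) ` F" using F' by simp
    have "0 \<le> sum d (J - {j})" using d0 by (intro sum_nonneg) auto
    moreover have "sum d J = d j + sum d (J - {j})" using J j by (rule sum.remove)
    ultimately have "0 \<le> 1 + sum d (J - {j})" "1 + sum d (J - {j}) < m + (m + 1) + d j"
      using m d[OF j] by linarith+
    then show False by (rule zero[OF vF v])
  qed
qed

text \<open>
  No proper face contains the origin, since every point of \<open>V\<close> has a negative multiple in the
  polytope. Hence a proper face contains at most one point of each pair \<open>u j, - u j\<close>. It does not contain all
  of \<open>a, b, c, e\<close>, so the bound could only fail if it contained three of them and one point of every
  pair. This is excluded by the preceding lemma, applied also after the exchange of \<open>a\<close> with \<open>b\<close>,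
  of \<open>c\<close> with \<open>e\<close> and of \<open>u\<close> with \<open>- u\<close>, which preserves both relations.
\<close>
lemma card_vertices_in_proper_face:
  fixes u :: "'j \<Rightarrow> 'a::real_vector" and d :: "'j \<Rightarrow> real"
  assumes J: "finite J"
    and V: "V = {a, b, c, e} \<union> (\<Union>j\<in>J. {u j, - u j})"
    and abce: "a + b + c + e = 0"
    and rel: "(\<Sum>j\<in>J. d j *\<^sub>R u j) = m *\<^sub>R b + (m + 1) *\<^sub>R e - c"
    and m: "0 \<le> m" "2 * m < sum d J" "sum d J < 2 * m + 4"
    and d: "\<And>j. j \<in> J \<Longrightarrow> sum d J - 2 * m < 2 * d j"
    and F: "F face_of convex hull V" "F \<noteq> convex hull V"
  shows "card (F \<inter> V) \<le> card J + 2"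
proof -
  let ?P = "convex hull V"
  have VP: "V \<subseteq> ?P" by (rule hull_subset)
  have P: "a \<in> ?P" "b \<in> ?P" "c \<in> ?P" "e \<in> ?P"
      "\<And>j. j \<in> J \<Longrightarrow> u j \<in> ?P" "\<And>j. j \<in> J \<Longrightarrow> - u j \<in> ?P"
    using VP V by auto
  have cv: "convex ?P" by (rule convex_convex_hull)
  have third: "- (1 / 3) *\<^sub>R x \<in> ?P"
    if "x + y + z + w = 0" "y \<in> ?P" "z \<in> ?P" "w \<in> ?P" for x y z w
  proof -
    have "1 *\<^sub>R y + 1 *\<^sub>R z + 1 *\<^sub>R w \<in> (*\<^sub>R) (1 + 1 + 1) ` ?P"
      using that by (intro scaled_add cv scaled_mem) auto
    then obtain p where p: "p \<in> ?P" "y + z + w = 3 *\<^sub>R p" by auto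
    have "x = - (y + z + w)" 
      unfolding eq_neg_iff_add_eq_0 using that(1) by (simp add: ac_simps)
    then have "- (1 / 3) *\<^sub>R x = p" using p by simp
    then show ?thesis using p by simp
  qed
  have neg: "- (1 / 3) *\<^sub>R x \<in> ?P" if "x \<in> {a, b, c, e}" for x
    using that P abce third[of a b c e] third[of b a c e] third[of c a b e] third[of e a b c]
    by (auto simp: ac_simps)
  have zeroP: "0 \<in> ?P"
  proof -
    have "1 *\<^sub>R a + 3 *\<^sub>R (- (1 / 3) *\<^sub>R a) \<in> (*\<^sub>R) (1 + 3) ` ?P"
      using P neg by (intro scaled_add cv scaled_mem) auto
    then show ?thesis by auto
  qed
  have F0: "0 \<notin> F"
  proof
    assume 0: "0 \<in> F"
    have "x \<in> F" if "x \<in> V" for x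
    proof (cases "x \<in> {a, b, c, e}")
      case True
      then show ?thesis
        using face_contains_if_zero[OF F(1) 0 _ neg[OF True]] that VP by auto
    next
      case False
      then have "x \<in> ?P" "- 1 *\<^sub>R x \<in> ?P" using that P V by auto
      then show ?thesis using face_contains_if_zero[OF F(1) 0, of x 1] by simp
    qed
    then have "?P \<subseteq> F" using face_of_imp_convex[OF F(1)] by (intro hull_minimal) auto
    then show False using F face_of_imp_subset by blast
  qed
  have anti: "\<not> (u j \<in> F \<and> - u j \<in> F)" if "j \<in> J" for j
  proof
    assume "u j \<in> F \<and> - u j \<in> F"
    then have "1 *\<^sub>R u j + 1 *\<^sub>R (- u j) \<in> (*\<^sub>R) (1 + 1) ` F"
      using face_of_imp_convex[OF F(1)] by (intro scaled_add scaled_mem) auto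
    then show False using F0 by auto
  qed
  note ex1 = excluded_subsets[OF F(1) cv zeroP F0 J P(5,6,1-4) abce rel m d]
  have swap: "b + a + e + c = 0" using abce by (simp add: ac_simps)
  have rel': "(\<Sum>j\<in>J. d j *\<^sub>R (- u j)) = m *\<^sub>R a + (m + 1) *\<^sub>R c - e"
  proof -
    have e: "e = - (a + b + c)" using minus_unique[OF abce] by simp
    have "(\<Sum>j\<in>J. d j *\<^sub>R (- u j)) = - (m *\<^sub>R b + (m + 1) *\<^sub>R e - c)"
      by (simp add: sum_negf rel)
    then show ?thesis unfolding e by (simp add: algebra_simps)
  qed
  have uu: "- (- u j) \<in> ?P" if "j \<in> J" for j using P(5)[OF that] by simp
  note ex2 = excluded_subsets[where u = "\<lambda>j. - u j",
      OF F(1) cv zeroP F0 J P(6) uu P(2,1,4,3) swap rel' m d]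
  let ?Q = "F \<inter> {a, b, c, e}" and ?U = "\<lambda>j. F \<inter> {u j, - u j}"
  have abce3: "\<not> (a \<in> F \<and> b \<in> F \<and> c \<in> F)" "\<not> (a \<in> F \<and> b \<in> F \<and> e \<in> F)"
    using ex1(1) ex2(1) by blast+
  have "?Q = set (filter (\<lambda>x. x \<in> F) [a, b, c, e])" by auto
  then have Q: "card ?Q \<le> length (filter (\<lambda>x. x \<in> F) [a, b, c, e])"
    by (metis card_length)
  have U1: "card (?U j) \<le> 1" if "j \<in> J" for j
    using anti[OF that] by (auto simp: Int_insert_right)
  have "F \<inter> V = ?Q \<union> (\<Union>j\<in>J. ?U j)" using V by auto
  then have "card (F \<inter> V) \<le> card ?Q + card (\<Union>j\<in>J. ?U j)"
    using card_Un_le by metis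
  also have "\<dots> \<le> card J + 2"
  proof (cases "\<forall>j\<in>J. u j \<in> F \<or> - u j \<in> F")
    case True
    have "\<not> (a \<in> F \<and> c \<in> F \<and> e \<in> F)"
      using ex1(2) ex2(3) True by blast
    moreover have "\<not> (b \<in> F \<and> c \<in> F \<and> e \<in> F)"
      using ex2(2) ex1(3) True by blast
    ultimately have "card ?Q \<le> 2"
      using Q abce3 by (simp split: if_splits)
    moreover have "card (\<Union>j\<in>J. ?U j) \<le> (\<Sum>j\<in>J. card (?U j))" by (rule card_UN_le[OF J])
    moreover have "(\<Sum>j\<in>J. card (?U j)) \<le> (\<Sum>j\<in>J. 1)" by (intro sum_mono U1)
    ultimately show ?thesis by simp
  next
    case False
    then obtain i where i: "i \<in> J" "?U i = {}" by auto
    then have "(\<Union>j\<in>J. ?U j) = (\<Union>j\<in>J - {i}. ?U j)" by blast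
    moreover have "card (\<Union>j\<in>J - {i}. ?U j) \<le> (\<Sum>j\<in>J - {i}. card (?U j))"
      using J by (intro card_UN_le) simp
    moreover have "(\<Sum>j\<in>J - {i}. card (?U j)) \<le> (\<Sum>j\<in>J - {i}. 1)" by (intro sum_mono U1) auto
    ultimately have "card (\<Union>j\<in>J. ?U j) \<le> card (J - {i})" by simp
    moreover have "card J = Suc (card (J - {i}))" by (rule card_Suc_Diff1[OF J i(1), symmetric])
    moreover have "card ?Q \<le> 3"
      using Q abce3 by (simp split: if_splits)
    ultimately show ?thesis by linarith
  qed
  finally show ?thesis .
qed

lemma card_vertices_in_proper_face_translated:
  fixes u :: "'j \<Rightarrow> 'a::real_vector" and d :: "'j \<Rightarrow> real"
  assumes J: "finite J"
    and V: "(\<lambda>v. - z + v) ` V = {a, b, c, e} \<union> (\<Union>j\<in>J. {u j, - u j})"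
    and abce: "a + b + c + e = 0"
    and rel: "(\<Sum>j\<in>J. d j *\<^sub>R u j) = m *\<^sub>R b + (m + 1) *\<^sub>R e - c"
    and m: "0 \<le> m" "2 * m < sum d J" "sum d J < 2 * m + 4"
    and d: "\<And>j. j \<in> J \<Longrightarrow> sum d J - 2 * m < 2 * d j"
    and F: "F face_of convex hull V" "F \<noteq> convex hull V"
  shows "card (F \<inter> V) \<le> card J + 2"
proof -
  let ?t = "(\<lambda>v. - z + v)"
  have "?t ` F face_of convex hull (?t ` V)" "?t ` F \<noteq> convex hull (?t ` V)"
    using F by (simp_all only: convex_hull_translation face_of_translation_eq inj_image_eq_iff[OF inj_on_add]
        not_False_eq_True)
  from card_vertices_in_proper_face[OF J V abce rel m d this]
  have "card (?t ` F \<inter> ?t ` V) \<le> card J + 2" by blast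
  moreover have "?t ` F \<inter> ?t ` V = ?t ` (F \<inter> V)" by (simp add: image_Int)
  ultimately show ?thesis by (simp add: card_image)
qed

section \<open>Arithmetic of finitely supported sequences\<close>

lemma lookup_scaleR_poly_mapping [simp]:
  "Poly_Mapping.lookup (r *\<^sub>R x) i = r * Poly_Mapping.lookup x i" for x :: "'a \<Rightarrow>\<^sub>0 real"
proof -
  have "{i. r *\<^sub>R Poly_Mapping.lookup x i \<noteq> 0} \<subseteq> {i. Poly_Mapping.lookup x i \<noteq> 0}" by auto
  then have "finite {i. r *\<^sub>R Poly_Mapping.lookup x i \<noteq> 0}"
    by (rule finite_subset) (rule finite_lookup)
  then show ?thesis by (simp add: scaleR_poly_mapping_def)
qed

lemma point_add:
  "length xs = length ys \<Longrightarrow> point xs + point ys = point (map2 (+) xs ys)"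
  by (rule poly_mapping_eqI) (simp add: lookup_add nth_default_def)

lemma point_diff:
  "length xs = length ys \<Longrightarrow> point xs - point ys = point (map2 (-) xs ys)"
  by (rule poly_mapping_eqI) (simp add: lookup_minus nth_default_def)

lemma point_uminus: "- point xs = point (map uminus xs)"
  by (rule poly_mapping_eqI) (simp add: nth_default_def)

lemma point_scaleR: "r *\<^sub>R point xs = point (map ((*) r) xs)"
  by (rule poly_mapping_eqI) (simp add: nth_default_def)

lemmas point_simps = point_add point_diff point_uminus point_scaleR

lemma point_zeros: "set xs \<subseteq> {0} \<Longrightarrow> point xs = 0"
  by (rule poly_mapping_eqI) (auto simp: nth_default_def dest!: nth_mem)

lemma point_inj:
  assumes "length xs = length ys"
  shows "point xs = point ys \<longleftrightarrow> xs = ys"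
proof
  assume eq: "point xs = point ys"
  have "xs ! i = ys ! i" if "i < length xs" for i
    using arg_cong[OF eq, of "\<lambda>x. Poly_Mapping.lookup x i"] that assms
    by (simp add: nth_default_def)
  then show "xs = ys" using assms by (simp add: nth_equalityI)
qed simp

lemma single_point:
  assumes "i < n"
  shows "Poly_Mapping.single i (1::real) = point ((replicate n 0)[i := 1])"
  by (rule poly_mapping_eqI) (use assms in \<open>auto simp: lookup_single nth_default_def nth_list_update when_def\<close>)

lemma all_ones_point: "all_ones d = point (replicate d 1)"
  by (rule poly_mapping_eqI)
    (auto simp: all_ones_def lookup_sum lookup_single nth_default_def when_def if_distrib sum.delta)

lemma lookup_all_ones: "Poly_Mapping.lookup (all_ones d) i = (if i < d then 1 else 0)"
  by (simp add: all_ones_point nth_default_def)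

section \<open>Polytopes spanned by cube vertices\<close>

text \<open>
  Comparing with the all-ones vector at every index, also beyond \<open>d\<close> where it vanishes, treats the
  coordinates and the support condition uniformly.
\<close>
lemma mem_zero_one_points:
  "x \<in> zero_one_points d \<longleftrightarrow>
     (\<forall>i. Poly_Mapping.lookup x i = 0 \<or> Poly_Mapping.lookup x i = Poly_Mapping.lookup (all_ones d) i)"
  unfolding zero_one_points_def lookup_all_ones
  by (auto simp: subset_iff in_keys_iff split: if_splits)

lemma point_zero_one:
  assumes "length xs = d" "set xs \<subseteq> {0, 1}"
  shows "point xs \<in> zero_one_points d"
  unfolding mem_zero_one_points lookup_all_ones using assms
  by (auto simp: nth_default_def dest!: nth_mem)

definition unit_cube :: "nat \<Rightarrow> (nat \<Rightarrow>\<^sub>0 real) set" where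
  "unit_cube d =
     {x. \<forall>i. 0 \<le> Poly_Mapping.lookup x i \<and> Poly_Mapping.lookup x i \<le> Poly_Mapping.lookup (all_ones d) i}"

lemma convex_unit_cube: "convex (unit_cube d)"
proof (rule convexI)
  fix x y :: "nat \<Rightarrow>\<^sub>0 real" and s t :: real
  assume "x \<in> unit_cube d" "y \<in> unit_cube d" and "0 \<le> s" "0 \<le> t" "s + t = 1"
  then show "s *\<^sub>R x + t *\<^sub>R y \<in> unit_cube d"
    by (simp add: unit_cube_def lookup_add convex_bound_le)
qed

lemma zero_one_points_subset_unit_cube: "zero_one_points d \<subseteq> unit_cube d"
proof
  fix x assume x: "x \<in> zero_one_points d"
  show "x \<in> unit_cube d"
    unfolding unit_cube_def mem_Collect_eq
  proof
    fix i
    have "Poly_Mapping.lookup x i = 0 \<or> Poly_Mapping.lookup x i = Poly_Mapping.lookup (all_ones d) i"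
      using x by (simp add: mem_zero_one_points)
    moreover have "0 \<le> Poly_Mapping.lookup (all_ones d) i" by (simp add: lookup_all_ones)
    ultimately show "0 \<le> Poly_Mapping.lookup x i \<and>
        Poly_Mapping.lookup x i \<le> Poly_Mapping.lookup (all_ones d) i"
      by auto
  qed
qed

lemma convex_hull_zero_one_subset:
  assumes "V \<subseteq> zero_one_points d"
  shows "convex hull V \<subseteq> unit_cube d"
  by (intro hull_minimal convex_unit_cube order_trans[OF assms zero_one_points_subset_unit_cube])

text \<open>
  In each coordinate, a value at an end of the interval is a proper convex combination only of itself.
\<close>
lemma zero_one_point_extreme:
  assumes "v \<in> zero_one_points d" "v \<in> S" "S \<subseteq> unit_cube d"
  shows "v extreme_point_of S"
  unfolding extreme_point_of_def
proof (intro conjI ballI notI)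
  fix a b assume ab: "a \<in> S" "b \<in> S" and v: "v \<in> open_segment a b"
  obtain t where t: "0 < t" "t < 1" "v = (1 - t) *\<^sub>R a + t *\<^sub>R b" and ne: "a \<noteq> b"
    using v by (auto simp: in_segment)
  have cube: "a \<in> unit_cube d" "b \<in> unit_cube d" using ab assms(3) by auto
  have "Poly_Mapping.lookup a i = Poly_Mapping.lookup b i" for i
  proof -
    define x y r where "x = Poly_Mapping.lookup a i" and "y = Poly_Mapping.lookup b i"
      and "r = Poly_Mapping.lookup (all_ones d) i"
    have xy: "0 \<le> x" "x \<le> r" "0 \<le> y" "y \<le> r"
      using cube by (auto simp: unit_cube_def x_def y_def r_def)
    have "Poly_Mapping.lookup v i = (1 - t) * x + t * y"
      by (simp add: t(3) lookup_add x_def y_def)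
    moreover have "Poly_Mapping.lookup v i = 0 \<or> Poly_Mapping.lookup v i = r"
      using assms(1) by (simp add: mem_zero_one_points r_def)
    ultimately consider "(1 - t) * x + t * y = 0" | "(1 - t) * (r - x) + t * (r - y) = 0"
      by (fastforce simp: algebra_simps)
    then have "x = y"
    proof cases
      case 1
      then show ?thesis using t xy by (simp add: add_nonneg_eq_0_iff)
    next
      case 2
      then show ?thesis using t xy by (simp add: add_nonneg_eq_0_iff)
    qed
    then show ?thesis by (simp add: x_def y_def)
  qed
  then have "a = b" by (intro poly_mapping_eqI)
  then show False using ne by simp
qed (rule assms)

lemma vertices_zero_one:
  assumes "V \<subseteq> zero_one_points d"
  shows "vertices (convex hull V) = V"
proof
  show "vertices (convex hull V) \<subseteq> V"
    by (auto simp: vertices_def extreme_point_of_convex_hull)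
  show "V \<subseteq> vertices (convex hull V)"
    unfolding vertices_def
    using zero_one_point_extreme[OF _ _ convex_hull_zero_one_subset[OF assms]] assms
    by (auto simp: hull_inc)
qed

lemma zero_one_in_convex_hull:
  assumes "V \<subseteq> zero_one_points d" "v \<in> zero_one_points d" "v \<in> convex hull V"
  shows "v \<in> V"
  using zero_one_point_extreme[OF assms(2,3) convex_hull_zero_one_subset[OF assms(1)]]
  by (rule extreme_point_of_convex_hull)

text \<open>
  The origin and the unit vectors form an affine basis of the space of sequences supported in
  \<open>{..<d}\<close>, which contains \<open>V\<close>; the last two hypotheses place this basis in the affine hull of \<open>V\<close>.
\<close>
lemma has_aff_dim_full:
  assumes V: "V \<subseteq> zero_one_points d" and 0: "0 \<in> affine hull V"
    and e: "\<And>i. i < d \<Longrightarrow> Poly_Mapping.single i 1 \<in> span V"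
  shows "has_aff_dim (convex hull V) (int d)"
proof -
  let ?e = "\<lambda>i. Poly_Mapping.single i (1::real)"
  let ?E = "?e ` {..<d}"
  have inj: "inj ?e" by (rule injI) (metis lookup_single_eq lookup_single_not_eq zero_neq_one)
  have expand: "x = (\<Sum>i<d. Poly_Mapping.lookup x i *\<^sub>R ?e i)"
    if "Poly_Mapping.keys x \<subseteq> {..<d}" for x
    using that
    by (intro poly_mapping_eqI)
      (auto simp: lookup_sum lookup_single when_def in_keys_iff subset_iff if_distrib cong: if_cong)
  have "independent ?E"
  proof (rule independent_if_scalars_zero)
    fix g x assume g: "(\<Sum>x\<in>?E. g x *\<^sub>R x) = 0" and "x \<in> ?E"
    then obtain i where i: "i < d" "x = ?e i" by blast
    have "(\<Sum>j<d. g (?e j) *\<^sub>R ?e j) = 0"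
      using g inj by (subst (asm) sum.reindex) (auto intro: inj_on_subset)
    then have "Poly_Mapping.lookup (\<Sum>j<d. g (?e j) *\<^sub>R ?e j) i = 0" by simp
    then show "g x = 0"
      using i by (simp add: lookup_sum lookup_single when_def if_distrib cong: if_cong)
  qed simp
  then have indep: "\<not> affine_dependent (insert 0 ?E)" using affine_dependent_imp_dependent2 by blast
  have "0 \<notin> ?E" by (metis (no_types, lifting) imageE lookup_single_eq lookup_zero zero_neq_one)
  then have card: "card (insert 0 ?E) = d + 1"
    by (simp add: card_image[OF inj_on_subset[OF inj subset_UNIV]])
  have "V \<subseteq> span ?E"
  proof
    fix v assume "v \<in> V"
    then have "Poly_Mapping.keys v \<subseteq> {..<d}" using V by (auto simp: zero_one_points_def)
    from expand[OF this] show "v \<in> span ?E"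
      by (metis (no_types, lifting) span_base span_scale span_sum imageI)
  qed
  then have "span V = span ?E" unfolding span_eq using e by auto
  then have "affine hull (insert 0 ?E) = affine hull V"
    by (simp add: affine_hull_span_0[OF 0] affine_hull_span_0 hull_inc span_insert_0)
  then show ?thesis
    unfolding has_aff_dim_def using indep card
    by (intro exI[of _ "insert 0 ?E"]) (simp add: affine_hull_convex_hull)
qed

section \<open>Symmetry of cross polytopes\<close>

text \<open>
  Pulling back the reflection of the standard cross polytope in the origin gives each \<open>x\<close> a partner
  \<open>y\<close> such that the midpoint of \<open>x\<close> and \<open>y\<close> is sent to the origin. The isomorphism is injective on
  the affine hull, so all these midpoints agree and \<open>x + y\<close> is constant.
\<close>
lemma cross_polytope_symmetric:
  assumes "cross_polytope d P"
  shows "\<exists>s. \<forall>x\<in>P. s - x \<in> P"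
proof -
  let ?C = "standard_cross_polytope d"
  obtain f a where f: "linear f" and inj: "inj_on (\<lambda>x. a + f x) (affine hull P)"
    and im: "(\<lambda>x. a + f x) ` P = ?C"
    using assms unfolding cross_polytope_def affinely_isomorphic_def by blast
  interpret f: linear f by (rule f)
  let ?G = "\<Union>i<d. {Poly_Mapping.single i 1, - Poly_Mapping.single i (1::real)}"
  have "uminus ` ?G = ?G" by (auto simp: image_iff)
  then have neg: "uminus ` ?C = ?C"
    unfolding standard_cross_polytope_def
    by (simp only: convex_hull_linear_image[OF linear_uminus])
  then have refl: "\<exists>y\<in>P. a + f y = - (a + f x)" if "x \<in> P" for x
  proof -
    have "a + f x \<in> ?C" using that im by blast
    then have "- (a + f x) \<in> (\<lambda>x. a + f x) ` P" using neg im by blast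
    then show ?thesis by (metis (mono_tags, lifting) imageE)
  qed
  have mid: "(1 / 2) *\<^sub>R x + (1 / 2) *\<^sub>R y \<in> affine hull P" if "x \<in> P" "y \<in> P" for x y
    using that by (intro mem_affine[OF affine_affine_hull] hull_inc) auto
  show ?thesis
  proof (cases "P = {}")
    case False
    then obtain x0 where x0: "x0 \<in> P" by blast
    obtain y0 where y0: "y0 \<in> P" "a + f y0 = - (a + f x0)" using refl[OF x0] by blast
    have "x0 + y0 - x \<in> P" if x: "x \<in> P" for x
    proof -
      obtain y where y: "y \<in> P" "a + f y = - (a + f x)" using refl[OF x] by blast
      have centre: "a + f ((1 / 2) *\<^sub>R p + (1 / 2) *\<^sub>R q) = 0" if "a + f q = - (a + f p)" for p q
      proof -
        have "2 *\<^sub>R (a + f ((1 / 2) *\<^sub>R p + (1 / 2) *\<^sub>R q)) = (a + f p) + (a + f q)"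
          by (simp add: f.add f.scale scaleR_add_right scaleR_2)
        then show ?thesis by (simp add: that)
      qed
      have "(1 / 2) *\<^sub>R x + (1 / 2) *\<^sub>R y = (1 / 2) *\<^sub>R x0 + (1 / 2) *\<^sub>R y0"
        by (rule inj_onD[OF inj _ mid[OF x y(1)] mid[OF x0 y0(1)]])
          (simp only: centre[OF y(2)] centre[OF y0(2)])
      then have "x + y = x0 + y0" by (simp flip: scaleR_add_right)
      then have "x0 + y0 - x = y" by (simp add: algebra_simps)
      then show ?thesis using y by simp
    qed
    then show ?thesis by blast
  qed simp
qed

text \<open>
  In each coordinate below \<open>d\<close>, one of the two antipodal points has value 0 and the other has value 1,
  so \<open>0 \<le> s - 1\<close> and \<open>s - 0 \<le> 1\<close> there.
\<close>
lemma centre_of_zero_one_polytope: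
  assumes V: "V \<subseteq> zero_one_points d" and v: "v \<in> V" "all_ones d - v \<in> V"
    and s: "\<And>x. x \<in> V \<Longrightarrow> s - x \<in> convex hull V"
  shows "s = all_ones d"
proof (rule poly_mapping_eqI)
  fix i
  let ?l = "\<lambda>x::nat \<Rightarrow>\<^sub>0 real. Poly_Mapping.lookup x i"
  have "s - v \<in> unit_cube d" "s - (all_ones d - v) \<in> unit_cube d"
    using s v convex_hull_zero_one_subset[OF V] by blast+
  then have "0 \<le> ?l s - ?l v" "?l s - ?l v \<le> ?l (all_ones d)"
      "0 \<le> ?l s - (?l (all_ones d) - ?l v)" "?l s - (?l (all_ones d) - ?l v) \<le> ?l (all_ones d)"
    by (simp_all add: unit_cube_def lookup_minus)
  moreover have "v \<in> zero_one_points d" using V v by blast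
  then have "?l v = 0 \<or> ?l v = ?l (all_ones d)" by (simp add: mem_zero_one_points)
  ultimately show "?l s = ?l (all_ones d)" by linarith
qed

section \<open>The counterexample\<close>

theorem theorem3p1:
  fixes V P :: "(nat \<Rightarrow>\<^sub>0 real) set"
  assumes V: "V =
      {point [0, 0, 1, 0, 1, 1, 0],
       point [1, 0, 1, 1, 1, 0, 1],
       point [1, 0, 0, 0, 1, 0, 0],
       point [1, 0, 0, 1, 0, 1, 0],
       point [0, 1, 1, 1, 0, 0, 0],
       point [1, 1, 0, 0, 0, 0, 1],
       point [0, 0, 1, 0, 0, 0, 1],
       point [0, 0, 0, 1, 1, 0, 0],
       point [0, 1, 0, 0, 0, 1, 0],
       point [1, 0, 0, 1, 1, 1, 1],
       point [1, 1, 0, 1, 1, 1, 0],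
       point [0, 1, 1, 0, 1, 0, 1],
       point [1, 1, 1, 0, 0, 1, 1],
       point [0, 1, 1, 1, 0, 1, 1]}"
    and P: "P = convex hull V"
  shows "V \<subseteq> zero_one_points 7 \<and>
    zero_one_polytope 7 P \<and>
    simplicial_polytope 7 P \<and>
    card (vertices P) = 14 \<and>
    \<not> centrally_symmetric 7 P \<and>
    \<not> (\<forall>d Q. zero_one_polytope d Q \<and> simplicial_polytope d Q \<and> card (vertices Q) = 2 * d
            \<longrightarrow> cross_polytope d Q)"
proof -
  have Z: "V \<subseteq> zero_one_points 7" unfolding V by (simp add: point_zero_one)
  have finV: "finite V" unfolding V by simp
  have vert: "vertices P = V" unfolding P by (rule vertices_zero_one[OF Z])
  have card: "card V = 14" unfolding V by (simp add: point_inj)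
  have ones: "all_ones 7 = point [1, 1, 1, 1, 1, 1, 1]"
    by (simp add: all_ones_point eval_nat_numeral)

  \<comment> \<open>The antipode of the first point is missing from \<open>V\<close>, that of the second is present.\<close>
  let ?p0 = "point [0, 0, 1, 0, 1, 1, 0]"
  have p0: "?p0 \<in> V" "all_ones 7 - ?p0 \<notin> V" "all_ones 7 - ?p0 \<in> zero_one_points 7"
    unfolding V ones by (simp_all add: point_diff point_inj point_zero_one)
  have p1: "point [1, 0, 1, 1, 1, 0, 1] \<in> V" "all_ones 7 - point [1, 0, 1, 1, 1, 0, 1] \<in> V"
    unfolding V ones by (simp_all add: point_diff)

  have dim: "has_aff_dim (convex hull V) (int 7)"
  proof (rule has_aff_dim_full[OF Z])
    \<comment> \<open>An affine combination: \<open>x1 + x2 + x3 - y1 - y2\<close> vanishes and its weights add up to 1.\<close>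
    define x1 x2 x3 y1 y2 where defs: "x1 = point [1, 0, 0, 0, 1, 0, 0]" "x2 = point [0, 0, 1, 0, 0, 0, 1]" "x3 = point [0, 1, 0, 0, 0, 1, 0]"
      "y1 = point [0, 0, 1, 0, 1, 1, 0]" "y2 = point [1, 1, 0, 0, 0, 0, 1]"
    let ?w = "\<lambda>x. if x \<in> {y1, y2} then - 1 else 1 :: real"
    have dist: "distinct [x1, x2, x3, y1, y2]" unfolding defs by (simp add: point_inj)
    have "(\<Sum>x\<in>{x1, x2, x3, y1, y2}. ?w x) = 1" using dist by simp
    moreover have "x1 + x2 + x3 - y1 - y2 = point [0, 0, 0, 0, 0, 0, 0]"
      unfolding defs by (simp add: point_simps point_zeros)
    then have "(\<Sum>x\<in>{x1, x2, x3, y1, y2}. ?w x *\<^sub>R x) = 0"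
      using dist by (simp add: point_zeros algebra_simps)
    moreover have "{x1, x2, x3, y1, y2} \<subseteq> V" unfolding V defs by simp
    ultimately show "0 \<in> affine hull V"
      unfolding affine_hull_explicit
      by (intro CollectI exI[of _ "{x1, x2, x3, y1, y2}"] exI[of _ ?w]) simp
  next
    have "point [1, 0, 1, 1, 1, 0, 1]
          - point [0, 0, 1, 0, 0, 0, 1]
          - point [0, 0, 0, 1, 1, 0, 0] \<in> span V"
      by (intro span_add span_diff span_scale span_base) (simp_all add: V)
    then have e0: "point [1, 0, 0, 0, 0, 0, 0] \<in> span V"
      by (simp add: point_simps)
    have "(1 / 2) *\<^sub>R (point [1, 1, 0, 0, 0, 0, 1] + point [0, 0, 0, 1, 1, 0, 0] + point [0, 1, 0, 0, 0, 1, 0]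
          - point [1, 0, 0, 1, 1, 1, 1]) \<in> span V"
      by (intro span_add span_diff span_scale span_base) (simp_all add: V)
    then have e1: "point [0, 1, 0, 0, 0, 0, 0] \<in> span V"
      by (simp add: point_simps)
    have "(1 / 2) *\<^sub>R (point [0, 0, 1, 0, 1, 1, 0] + point [0, 1, 1, 1, 0, 0, 0]
          - point [0, 0, 0, 1, 1, 0, 0]
          - point [0, 1, 0, 0, 0, 1, 0]) \<in> span V"
      by (intro span_add span_diff span_scale span_base) (simp_all add: V)
    then have e2: "point [0, 0, 1, 0, 0, 0, 0] \<in> span V"
      by (simp add: point_simps)
    have "point [1, 0, 1, 1, 1, 0, 1]
          - point [1, 0, 0, 0, 1, 0, 0]
          - point [0, 0, 1, 0, 0, 0, 1] \<in> span V"
      by (intro span_add span_diff span_scale span_base) (simp_all add: V)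
    then have e3: "point [0, 0, 0, 1, 0, 0, 0] \<in> span V"
      by (simp add: point_simps)
    have "point [0, 0, 1, 0, 1, 1, 0] + point [1, 1, 0, 0, 0, 0, 1]
          - point [1, 1, 1, 0, 0, 1, 1] \<in> span V"
      by (intro span_add span_diff span_scale span_base) (simp_all add: V)
    then have e4: "point [0, 0, 0, 0, 1, 0, 0] \<in> span V"
      by (simp add: point_simps)
    have "(1 / 2) *\<^sub>R (point [1, 0, 0, 1, 1, 1, 1] + point [1, 1, 1, 0, 0, 1, 1]
          - point [1, 0, 1, 1, 1, 0, 1]
          - point [1, 1, 0, 0, 0, 0, 1]) \<in> span V"
      by (intro span_add span_diff span_scale span_base) (simp_all add: V)
    then have e5: "point [0, 0, 0, 0, 0, 1, 0] \<in> span V"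
      by (simp add: point_simps)
    have "point [1, 0, 0, 1, 1, 1, 1] + point [1, 1, 1, 0, 0, 1, 1]
          - point [0, 0, 1, 0, 1, 1, 0]
          - point [1, 0, 0, 1, 0, 1, 0]
          - point [1, 1, 0, 0, 0, 0, 1] \<in> span V"
      by (intro span_add span_diff span_scale span_base) (simp_all add: V)
    then have e6: "point [0, 0, 0, 0, 0, 0, 1] \<in> span V"
      by (simp add: point_simps)
    fix i :: nat assume i: "i < 7"
    then consider "i = 0" | "i = 1" | "i = 2" | "i = 3" | "i = 4" | "i = 5" | "i = 6" by linarith
    then have "point ((replicate 7 0)[i := 1]) \<in> span V"
      using e0 e1 e2 e3 e4 e5 e6 by cases (simp_all add: eval_nat_numeral)
    then show "Poly_Mapping.single i 1 \<in> span V" by (simp add: single_point[OF i])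
  qed

  have few: "card (F \<inter> V) \<le> 7" if F: "F face_of convex hull V" "F \<noteq> convex hull V" for F
  proof -
    define z where "z = point [1/2, 1/2, 1/2, 1/2, 1/2, 1/2, 1/2]"
    define a b c e where "a = - z + point [0, 0, 1, 0, 1, 1, 0]"
      and "b = - z + point [0, 1, 1, 1, 0, 0, 0]"
      and "c = - z + point [1, 1, 0, 0, 0, 0, 1]"
      and "e = - z + point [1, 0, 0, 1, 1, 1, 1]"
    define u where "u = (\<lambda>j. - z + [point [1, 0, 1, 1, 1, 0, 1], point [1, 0, 0, 1, 0, 1, 0],
        point [0, 0, 0, 1, 1, 0, 0], point [1, 1, 0, 1, 1, 1, 0], point [0, 1, 1, 1, 0, 1, 1]] ! j)"
    define d where "d = (\<lambda>j. [3, 2, 3, 2, 4] ! j :: real)"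
    note defs = a_def b_def c_def e_def u_def d_def z_def
    have five: "{..<5::nat} = {0, 1, 2, 3, 4}" by auto
    have "(\<lambda>v. - z + v) ` V = {a, b, c, e} \<union> (\<Union>j\<in>{..<5}. {u j, - u j})"
      unfolding five V defs by (intro equalityI) (simp_all add: point_simps)
    moreover have "a + b + c + e = 0"
      unfolding defs by (simp add: point_simps point_zeros)
    \<comment> \<open>The weights solve a linear system: up to scaling and a multiple of the previous relation
      this is the only linear relation between the five \<open>u j\<close> and \<open>a\<close>, \<open>b\<close>, \<open>c\<close>, \<open>e\<close>.\<close>
    moreover have "(\<Sum>j<5. d j *\<^sub>R u j) = 6 *\<^sub>R b + (6 + 1) *\<^sub>R e - c"
      unfolding five defs by (simp add: point_simps)
    moreover have sum_d: "sum d {..<5} = 14" unfolding five d_def by simp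
    moreover have "sum d {..<5} - 2 * 6 < 2 * d j" if "j \<in> {..<5}" for j
      using that unfolding sum_d five d_def by auto
    ultimately have "card (F \<inter> V) \<le> card {..<5::nat} + 2"
      using F by (intro card_vertices_in_proper_face_translated[where m = 6 and d = d]) simp_all
    then show ?thesis by simp
  qed

  have simplicial: "simplicial_polytope 7 P"
    unfolding P by (rule simplicial_polytope_if_faces_small[OF finV dim few])

  have not_cross: "\<not> cross_polytope 7 P"
  proof
    assume "cross_polytope 7 P"
    then obtain s where s: "\<And>x. x \<in> P \<Longrightarrow> s - x \<in> P" using cross_polytope_symmetric by blast
    then have "s - x \<in> convex hull V" if "x \<in> V" for x
      using that unfolding P by (simp add: hull_inc)
    then have "s = all_ones 7" by (rule centre_of_zero_one_polytope[OF Z p1])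
    then have "all_ones 7 - ?p0 \<in> convex hull V" using s p0(1) unfolding P by (metis hull_inc)
    then show False using zero_one_in_convex_hull[OF Z p0(3)] p0(2) by blast
  qed
  have "zero_one_polytope 7 P" using Z P unfolding zero_one_polytope_def by blast
  moreover have "\<not> centrally_symmetric 7 P"
    using p0 unfolding centrally_symmetric_def vert by blast
  moreover have "card (vertices P) = 2 * 7" using card vert by simp
  ultimately show ?thesis using Z simplicial not_cross card vert by blast
qed

end
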